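(* The group $\mathbb{Z}$ has the tournament 2-RZ property, and so $\mathbb{Z}$ has finite approximability on tournaments, i.e., every action of $\mathbb{Z}$ by automorphisms on a tournament is finitely approximable.
   Context: A subgroup $H$ of a countable group $\Gamma$ is good if there are no $g\in\Gamma\setminus H$ and $h\in H$ such that $ghg\in H$. A countable group $\Gamma$ has the tournament 2-RZ property if for any $g_i\in\Gamma$, $i\leq n$, any finitely generated good subgroups $K_i,H_i\leq\Gamma$, $i\leq n$, such that $g_i\notin K_iH_i$, and any finitely generated good subgroups $M_j\leq\Gamma$, $j\leq m$, there exists a finite index normal subgroup $N\leq\Gamma$ such that $g_i\notin K_iH_iN$ for each $i\leq n$, and $M_jN$ is good for each $j\leq m$. A tournament is a directed graph $(X,R)$ (without loops) such that for any distinct $x,y\in X$ exactly one of the arrows $(x,y)$, $(y,x)$ is in $R$; $X$ may be infinite. An action $\alpha$ of $\Gamma$ by automorphisms on a tournament $X$ is finitely approximable if for every finite $F\subseteq\Gamma$ containing the identity and every finite $X_0\subseteq X$ there exist a finite tournament $Y$, an action $\beta$ of $\Gamma$ on $Y$ by automorphisms, and an injection $e:\alpha[F\times X_0]\to Y$ which is an embedding of the substructure of $X$ induced on $\alpha[F\times X_0]=\{\alpha(f,x): f\in F, x\in X_0\}$ into $Y$ and satisfies $\beta(f,e(x))=e(\alpha(f,x))$ for all $f\in F$, $x\in X_0$. *)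

theory Defs
  imports
    "HOL-Algebra.Elementary_Groups"
    "HOL-Algebra.Group_Action"
    "HOL-Library.Countable_Set"
begin

definition good_subgroup :: "('a, 'b) monoid_scheme \<Rightarrow> 'a set \<Rightarrow> bool" where
  "good_subgroup G H \<longleftrightarrow>
     subgroup H G \<and>
     \<not> (\<exists>g \<in> carrier G - H. \<exists>h \<in> H. g \<otimes>\<^bsub>G\<^esub> h \<otimes>\<^bsub>G\<^esub> g \<in> H)"

definition fin_gen_subgroup :: "('a, 'b) monoid_scheme \<Rightarrow> 'a set \<Rightarrow> bool" where
  "fin_gen_subgroup G H \<longleftrightarrow> (\<exists>S. finite S \<and> S \<subseteq> carrier G \<and> H = generate G S)"

text \<open>The indices \<open>i = 1, \<dots>, n\<close> and \<open>j = 1, \<dots>, m\<close> are rendered as \<open>i < n\<close> and \<open>j < m\<close>.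
  The standing assumption that \<open>G\<close> is a countable group is part of the property.\<close>

definition tournament_2RZ :: "('a, 'b) monoid_scheme \<Rightarrow> bool" where
  "tournament_2RZ G \<longleftrightarrow>
     group G \<and> countable (carrier G) \<and>
     (\<forall>(n::nat) (m::nat) (g :: nat \<Rightarrow> 'a) (K :: nat \<Rightarrow> 'a set) (H :: nat \<Rightarrow> 'a set)
        (M :: nat \<Rightarrow> 'a set).
        (\<forall>i<n. g i \<in> carrier G \<and>
               fin_gen_subgroup G (K i) \<and> good_subgroup G (K i) \<and>
               fin_gen_subgroup G (H i) \<and> good_subgroup G (H i) \<and>
               g i \<notin> K i <#>\<^bsub>G\<^esub> H i) \<and>
        (\<forall>j<m. fin_gen_subgroup G (M j) \<and> good_subgroup G (M j)) \<longrightarrow>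
        (\<exists>N. N \<lhd> G \<and> finite (rcosets\<^bsub>G\<^esub> N) \<and>
             (\<forall>i<n. g i \<notin> K i <#>\<^bsub>G\<^esub> H i <#>\<^bsub>G\<^esub> N) \<and>
             (\<forall>j<m. good_subgroup G (M j <#>\<^bsub>G\<^esub> N))))"

definition tournament :: "'x set \<Rightarrow> ('x \<times> 'x) set \<Rightarrow> bool" where
  "tournament X R \<longleftrightarrow>
     R \<subseteq> X \<times> X \<and>
     (\<forall>x\<in>X. (x, x) \<notin> R) \<and>
     (\<forall>x\<in>X. \<forall>y\<in>X. x \<noteq> y \<longrightarrow> ((x, y) \<in> R \<longleftrightarrow> (y, x) \<notin> R))"

definition acts_by_automorphisms ::
  "('a, 'b) monoid_scheme \<Rightarrow> 'x set \<Rightarrow> ('x \<times> 'x) set \<Rightarrow> ('a \<Rightarrow> 'x \<Rightarrow> 'x) \<Rightarrow> bool" where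
  "acts_by_automorphisms G X R \<alpha> \<longleftrightarrow>
     group_action G X \<alpha> \<and>
     (\<forall>g \<in> carrier G. \<forall>x\<in>X. \<forall>y\<in>X. (x, y) \<in> R \<longleftrightarrow> (\<alpha> g x, \<alpha> g y) \<in> R)"

text \<open>Every finite tournament is isomorphic to one whose vertices are natural numbers, so the
  existential quantifier over finite tournaments \<open>(Y, S)\<close> ranges over sets of naturals.\<close>

definition finitely_approximable ::
  "('a, 'b) monoid_scheme \<Rightarrow> 'x set \<Rightarrow> ('x \<times> 'x) set \<Rightarrow> ('a \<Rightarrow> 'x \<Rightarrow> 'x) \<Rightarrow> bool" where
  "finitely_approximable G X R \<alpha> \<longleftrightarrow>
     (\<forall>F X0. finite F \<and> F \<subseteq> carrier G \<and> \<one>\<^bsub>G\<^esub> \<in> F \<and> finite X0 \<and> X0 \<subseteq> X \<longrightarrow>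
        (let D = {\<alpha> f x | f x. f \<in> F \<and> x \<in> X0} in
         \<exists>(Y :: nat set) S \<beta> e.
           finite Y \<and> tournament Y S \<and> acts_by_automorphisms G Y S \<beta> \<and>
           e ` D \<subseteq> Y \<and> inj_on e D \<and>
           (\<forall>u\<in>D. \<forall>v\<in>D. (u, v) \<in> R \<longleftrightarrow> (e u, e v) \<in> S) \<and>
           (\<forall>f\<in>F. \<forall>x\<in>X0. \<beta> f (e x) = e (\<alpha> f x))))"

end

theory Submission
  imports Defs
begin

text \<open>
  A subgroup \<open>n\<int>\<close> is good exactly when \<open>n\<close> is zero or odd, since goodness says that \<open>2 g \<in> n\<int>\<close>
  forces \<open>g \<in> n\<int>\<close> (\<open>good_subgroup_multiples_iff\<close>). Finitely many such subgroups can therefore be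
  handled by one modulus \<open>L\<close>: an odd number, as large as desired, that every nonzero generator
  divides (\<open>ex_large_odd_common_multiple\<close>). Both halves of the theorem use such an \<open>L\<close>.

  For the tournament 2-RZ property take \<open>N = L\<int>\<close>. Every nonzero subgroup in question contains \<open>N\<close>
  and is unchanged by adding it; for the zero subgroup, \<open>N\<close> itself is good because \<open>L\<close> is odd,
  and \<open>g \<noteq> 0\<close> stays outside \<open>N\<close> because \<open>L\<close> is large.

  For the approximation of an action on a tournament \<open>X\<close>, stabilizers of points are good
  (\<open>good_stabilizer\<close>): if \<open>g h g\<close> and \<open>h\<close> fix \<open>x\<close>, then \<open>g h\<close> carries the pair \<open>(x, g x)\<close> to
  \<open>(g x, x)\<close>. So an orbit is infinite or an odd cycle. Given finitely many points, choose \<open>L\<close> for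
  the stabilizers of the orbits that they meet and let the finite model keep the finite orbits and
  wrap each infinite one into a cycle of length \<open>L\<close>. In the model, the arrow between position \<open>a\<close>
  of the orbit of \<open>x\<close> and position \<open>b\<close> of the orbit of \<open>y\<close> is the arrow of \<open>X\<close> between \<open>x\<close> and
  \<open>c y\<close>, where \<open>c\<close> is the representative of \<open>b - a\<close> modulo \<open>L\<close> of least absolute value. Each
  property of \<open>L\<close> has its task. As \<open>L\<close> is odd, the representative of \<open>- c\<close> is minus that of \<open>c\<close>,
  so exactly one of two opposite arrows is present (\<open>model_edge_flip\<close>). As the finite orbit lengths
  divide \<open>L\<close>, the arrow depends only on the positions modulo the cycle lengths, so rotation is an
  automorphism (\<open>model_edge_mod\<close>). As \<open>L\<close> is large, reduction modulo \<open>L\<close> does nothing to the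
  differences between the given points, so these are embedded (\<open>emb_edge\<close>).
\<close>

section \<open>Good subgroups of the integers\<close>

abbreviation multiples :: "int \<Rightarrow> int set" where
  "multiples n \<equiv> {k. n dvd k}"

lemma subgroup_multiples: "subgroup (multiples n) integer_group"
  by (rule group.subgroupI [OF group_integer_group]) auto

lemma subgroup_integer_group_eq_multiples:
  assumes "subgroup H integer_group"
  shows "\<exists>n\<ge>0. H = multiples n"
proof -
  interpret H: subgroup H integer_group by fact
  have add: "a + b \<in> H" if "a \<in> H" "b \<in> H" for a b
    using H.m_closed [OF that] by simp
  have neg: "- a \<in> H" if "a \<in> H" for a
    using group.subgroupE(3) [OF group_integer_group assms that] by simp
  have zero: "0 \<in> H"
    using H.one_closed by simp
  have mult_nat: "int k * a \<in> H" if "a \<in> H" for k a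
    by (induction k) (auto simp: algebra_simps zero intro: add that)
  have mult: "k * a \<in> H" if "a \<in> H" for k a
    using mult_nat [OF that, of "nat k"] neg [OF mult_nat [OF that, of "nat (- k)"]]
    by (cases "k \<ge> 0") auto
  show ?thesis
  proof (cases "\<exists>a\<in>H. a \<noteq> 0")
    case False
    then have "H = multiples 0" using zero by auto
    then show ?thesis by blast
  next
    case True
    then obtain a where a: "a \<in> H" "a \<noteq> 0" by blast
    \<comment> \<open>The least positive element generates, by division with remainder.\<close>
    define P where "P k \<longleftrightarrow> k > 0 \<and> int k \<in> H" for k
    have "P (nat \<bar>a\<bar>)"
      using a neg unfolding P_def by (auto simp: abs_if)
    define n where "n = (LEAST k. P k)"
    have n: "n > 0" "int n \<in> H"
      using LeastI [of P, OF \<open>P (nat \<bar>a\<bar>)\<close>] by (auto simp: n_def P_def)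
    have "int n dvd b" if "b \<in> H" for b
    proof (rule ccontr)
      assume "\<not> int n dvd b"
      then have pos: "b mod int n > 0"
        using n pos_mod_sign [of "int n" b] unfolding dvd_eq_mod_eq_0 by linarith
      have eq: "b mod int n = b + - (b div int n) * int n"
        using minus_div_mult_eq_mod [of b "int n"] by linarith
      have "b mod int n \<in> H"
        unfolding eq by (intro add that mult n)
      then have "P (nat (b mod int n))"
        using pos by (simp add: P_def)
      then have "n \<le> nat (b mod int n)"
        unfolding n_def by (rule Least_le)
      moreover have "b mod int n < int n"
        using n(1) by simp
      ultimately show False using pos by linarith
    qed
    then have "H = multiples (int n)"
      using mult [OF n(2)] by (auto elim!: dvdE simp: mult.commute)
    then show ?thesis by (metis of_nat_0_le_iff)
  qed
qed

text \<open>In additive notation, goodness of \<open>H\<close> says that \<open>2 g \<in> H\<close> forces \<open>g \<in> H\<close>; an even nonzero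
  generator \<open>n\<close> violates this at \<open>g = n / 2\<close>.\<close>

lemma good_subgroup_multiples_iff:
  "good_subgroup integer_group (multiples n) \<longleftrightarrow> n = 0 \<or> odd n"
proof
  assume good: "good_subgroup integer_group (multiples n)"
  have halve: "n dvd g" if "n dvd 2 * g" for g
    using good that by (fastforce simp: good_subgroup_def)
  show "n = 0 \<or> odd n"
  proof (rule ccontr)
    assume "\<not> ?thesis"
    then obtain k where k: "n = 2 * k" "k \<noteq> 0" by auto
    then have "2 * k dvd k" using halve [of k] by simp
    then show False
      using k(2) dvd_mult_cancel_right [of 2 k 1] by simp
  qed
next
  assume n: "n = 0 \<or> odd n"
  have "n dvd g" if "n dvd h" "n dvd g + h + g" for g h
  proof -
    have "n dvd (g + h + g) - h" using that by (rule dvd_diff [rotated])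
    then have "n dvd 2 * g" by (simp add: algebra_simps)
    then show ?thesis
      using n by (auto simp: coprime_dvd_mult_right_iff)
  qed
  then show "good_subgroup integer_group (multiples n)"
    using subgroup_multiples unfolding good_subgroup_def mult_integer_group by blast
qed

lemma good_subgroup_integer_groupD:
  assumes "good_subgroup integer_group H"
  shows "\<exists>n. H = multiples n \<and> (n = 0 \<or> odd n)"
proof -
  obtain n where "H = multiples n"
    using assms subgroup_integer_group_eq_multiples unfolding good_subgroup_def by blast
  with assms show ?thesis
    using good_subgroup_multiples_iff by metis
qed

lemma ex_large_odd_common_multiple:
  fixes A :: "int set"
  assumes "finite A" and odd: "\<And>n. n \<in> A \<Longrightarrow> n = 0 \<or> odd n"
  shows "\<exists>L. odd L \<and> L > B \<and> L > 0 \<and> (\<forall>n\<in>A. n \<noteq> 0 \<longrightarrow> n dvd L)"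
proof -
  let ?p = "\<Prod>n\<in>A - {0}. \<bar>n\<bar>"
  \<comment> \<open>The odd factor \<open>2 \<bar>B\<bar> + 1\<close> alone makes the product exceed \<open>B\<close>.\<close>
  let ?L = "(2 * \<bar>B\<bar> + 1) * ?p"
  have p: "?p > 0" by (rule prod_pos) simp
  then have le: "2 * \<bar>B\<bar> + 1 \<le> ?L"
    using mult_left_mono [of 1 ?p "2 * \<bar>B\<bar> + 1"] by simp
  have "odd ?p"
    using odd assms(1) by (auto simp: even_prod_iff)
  then have "odd ?L" by simp
  moreover have "n dvd ?L" if "n \<in> A" "n \<noteq> 0" for n
  proof -
    have "\<bar>n\<bar> dvd ?p" using that assms(1) by (intro dvd_prodI) auto
    then show ?thesis by (simp add: dvd_mult)
  qed
  moreover have "?L > B" "?L > 0" using le by linarith+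
  ultimately show ?thesis by blast
qed

section \<open>The tournament 2-RZ property\<close>

lemma set_mult_integer_group: "K <#>\<^bsub>integer_group\<^esub> H = {k + h | k h. k \<in> K \<and> h \<in> H}"
  by (auto simp: set_mult_def)

text \<open>A nonzero \<open>n\<int>\<close> survives the passage to the quotient by \<open>L\<int>\<close> when \<open>n\<close> divides \<open>L\<close>.\<close>

lemma set_mult_multiples_absorb:
  assumes "n dvd L"
  shows "multiples n <#>\<^bsub>integer_group\<^esub> multiples L = multiples n"
proof (intro equalityI subsetI)
  fix k assume "k \<in> multiples n"
  then have "k = k + 0 \<and> n dvd k \<and> L dvd 0" by simp
  then show "k \<in> multiples n <#>\<^bsub>integer_group\<^esub> multiples L"
    unfolding set_mult_integer_group by blast
qed (use assms in \<open>auto simp: set_mult_integer_group intro: dvd_add dvd_trans\<close>)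

lemma set_mult_zero:
  "{0} <#>\<^bsub>integer_group\<^esub> H = H" "H <#>\<^bsub>integer_group\<^esub> {0} = H"
  by (auto simp: set_mult_integer_group)

lemma set_mult_integer_group_assoc:
  "(A <#>\<^bsub>integer_group\<^esub> B) <#>\<^bsub>integer_group\<^esub> C = A <#>\<^bsub>integer_group\<^esub> (B <#>\<^bsub>integer_group\<^esub> C)"
  by (rule group.set_mult_assoc [OF group_integer_group]) simp_all

lemma set_mult_integer_group_commute:
  "A <#>\<^bsub>integer_group\<^esub> B = B <#>\<^bsub>integer_group\<^esub> A"
  unfolding set_mult_integer_group by (subst add.commute) blast

lemma finite_index_multiples:
  assumes "L > 0"
  shows "finite (rcosets\<^bsub>integer_group\<^esub> (multiples L))"
proof -
  have "multiples L #>\<^bsub>integer_group\<^esub> a = multiples L #>\<^bsub>integer_group\<^esub> (a mod L)" for a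
  proof (rule group.repr_independence [OF group_integer_group _ _ subgroup_multiples])
    have "a mod L = (- (a div L) * L) + a"
      using minus_div_mult_eq_mod [of a L] by linarith
    then show "a mod L \<in> multiples L #>\<^bsub>integer_group\<^esub> a"
      unfolding r_coset_def by (intro UN_I [of "- (a div L) * L"]) simp_all
  qed simp
  moreover have "a mod L \<in> {0..<L}" for a
    using assms by simp
  ultimately have "rcosets\<^bsub>integer_group\<^esub> (multiples L)
      \<subseteq> (\<lambda>a. multiples L #>\<^bsub>integer_group\<^esub> a) ` {0..<L}"
    unfolding RCOSETS_def by blast
  then show ?thesis by (rule finite_subset) simp
qed

lemma tournament_2RZ_integer_group: "tournament_2RZ integer_group"
  unfolding tournament_2RZ_def
proof (intro conjI allI impI)
  show "group integer_group" by simp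
  show "countable (carrier integer_group :: int set)" by simp
next
  fix n m :: nat and g :: "nat \<Rightarrow> int" and K H M :: "nat \<Rightarrow> int set"
  let ?good = "good_subgroup integer_group"
  let ?mul = "\<lambda>A B. A <#>\<^bsub>integer_group\<^esub> B"
  assume *: "(\<forall>i<n. g i \<in> carrier integer_group \<and>
               fin_gen_subgroup integer_group (K i) \<and> ?good (K i) \<and>
               fin_gen_subgroup integer_group (H i) \<and> ?good (H i) \<and>
               g i \<notin> ?mul (K i) (H i)) \<and>
        (\<forall>j<m. fin_gen_subgroup integer_group (M j) \<and> ?good (M j))"
  have good: "\<And>i. i < n \<Longrightarrow> ?good (K i)" "\<And>i. i < n \<Longrightarrow> ?good (H i)" "\<And>j. j < m \<Longrightarrow> ?good (M j)"
    and g: "\<And>i. i < n \<Longrightarrow> g i \<notin> ?mul (K i) (H i)"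
    using * by blast+
  obtain k where K: "\<And>i. i < n \<Longrightarrow> K i = multiples (k i) \<and> (k i = 0 \<or> odd (k i))"
    using good_subgroup_integer_groupD [OF good(1)] by metis
  obtain h where H: "\<And>i. i < n \<Longrightarrow> H i = multiples (h i) \<and> (h i = 0 \<or> odd (h i))"
    using good_subgroup_integer_groupD [OF good(2)] by metis
  obtain l where M: "\<And>j. j < m \<Longrightarrow> M j = multiples (l j) \<and> (l j = 0 \<or> odd (l j))"
    using good_subgroup_integer_groupD [OF good(3)] by metis
  define A where "A = k ` {..<n} \<union> h ` {..<n} \<union> l ` {..<m}"
  have "finite A" unfolding A_def by simp
  moreover have "a = 0 \<or> odd a" if "a \<in> A" for a
    using that K H M unfolding A_def by blast
  ultimately obtain L where L: "odd L" "L > (\<Sum>i<n. \<bar>g i\<bar>)" "L > 0"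
    "\<And>a. a \<in> A \<Longrightarrow> a \<noteq> 0 \<Longrightarrow> a dvd L"
    using ex_large_odd_common_multiple [of A "\<Sum>i<n. \<bar>g i\<bar>"] by metis
  let ?N = "multiples L"
  have "g i \<notin> ?mul (?mul (K i) (H i)) ?N" if i: "i < n" for i
  proof (cases "k i = 0 \<and> h i = 0")
    \<comment> \<open>Here \<open>K H\<close> is zero, and a nonzero \<open>g\<close> is too small to be a multiple of \<open>L\<close>.\<close>
    case True
    have "0 \<in> ?mul (K i) (H i)"
      using True K [OF i] H [OF i] by (simp add: set_mult_zero)
    then have "g i \<noteq> 0" using g [OF i] by metis
    moreover have "\<bar>g i\<bar> \<le> (\<Sum>i<n. \<bar>g i\<bar>)"
      using i by (intro member_le_sum) auto
    ultimately have "\<not> L dvd g i"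
      using L(2) dvd_imp_le_int [of "g i" L] by linarith
    then show ?thesis
      using True K [OF i] H [OF i] by (simp add: set_mult_zero)
  next
    \<comment> \<open>A nonzero factor of \<open>K H\<close> already contains \<open>N\<close>.\<close>
    case False
    then have "?mul (K i) ?N = K i \<or> ?mul (H i) ?N = H i"
      using L(4) [of "k i"] L(4) [of "h i"] i K [OF i] H [OF i]
      by (auto simp: A_def set_mult_multiples_absorb)
    then have "?mul (?mul (K i) (H i)) ?N = ?mul (K i) (H i)"
      by (metis set_mult_integer_group_assoc set_mult_integer_group_commute)
    then show ?thesis using g [OF i] by simp
  qed
  moreover have "?good (?mul (M j) ?N)" if j: "j < m" for j
  proof (cases "l j = 0")
    case True
    then show ?thesis
      using M [OF j] L(1) good_subgroup_multiples_iff [of L]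
      by (simp add: set_mult_zero)
  next
    case False
    then have "?mul (M j) ?N = M j"
      using M [OF j] L(4) [of "l j"] j by (auto simp: A_def set_mult_multiples_absorb)
    then show ?thesis using good(3) [OF j] by simp
  qed
  moreover have "?N \<lhd> integer_group"
    by (rule comm_group.subgroup_imp_normal [OF abelian_integer_group subgroup_multiples])
  ultimately show "\<exists>N. N \<lhd> integer_group \<and> finite (rcosets\<^bsub>integer_group\<^esub> N) \<and>
             (\<forall>i<n. g i \<notin> ?mul (?mul (K i) (H i)) N) \<and> (\<forall>j<m. ?good (?mul (M j) N))"
    using finite_index_multiples [OF L(3)] by blast
qed

section \<open>Constructing and transporting actions on tournaments\<close>

text \<open>Group actions are homomorphisms into a group of extensional bijections; this criterion
  reduces them to the pointwise axioms.\<close>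

lemma group_action_restrictI:
  assumes "group G"
    and closed: "\<And>g x. g \<in> carrier G \<Longrightarrow> x \<in> E \<Longrightarrow> f g x \<in> E"
    and one: "\<And>x. x \<in> E \<Longrightarrow> f \<one>\<^bsub>G\<^esub> x = x"
    and mult: "\<And>g h x. g \<in> carrier G \<Longrightarrow> h \<in> carrier G \<Longrightarrow> x \<in> E \<Longrightarrow>
      f (g \<otimes>\<^bsub>G\<^esub> h) x = f g (f h x)"
  shows "group_action G E (\<lambda>g. restrict (f g) E)"
proof -
  interpret group G by fact
  have bij: "restrict (f g) E \<in> Bij E" if g: "g \<in> carrier G" for g
  proof -
    have "bij_betw (f g) E E"
    proof (rule bij_betw_byWitness [where f' = "f (inv\<^bsub>G\<^esub> g)"])
      show "\<forall>x\<in>E. f (inv\<^bsub>G\<^esub> g) (f g x) = x" "\<forall>x\<in>E. f g (f (inv\<^bsub>G\<^esub> g) x) = x"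
        using g by (simp_all flip: mult add: one)
    qed (use closed g in auto)
    then show ?thesis by (simp add: Bij_def bij_betw_restrict_eq)
  qed
  have "group_hom G (BijGroup E) (\<lambda>g. restrict (f g) E)"
  proof (rule group_hom.intro [OF assms(1) group_BijGroup], rule group_hom_axioms.intro, rule homI)
    fix g h assume "g \<in> carrier G" "h \<in> carrier G"
    then show "restrict (f (g \<otimes>\<^bsub>G\<^esub> h)) E =
        restrict (f g) E \<otimes>\<^bsub>BijGroup E\<^esub> restrict (f h) E"
      using bij by (auto simp: BijGroup_def compose_def mult closed fun_eq_iff)
  qed (use bij in \<open>simp add: BijGroup_def\<close>)
  then show ?thesis by (rule group_action.intro)
qed

lemma map_prod_image_iff:
  assumes "inj_on j Y" "S \<subseteq> Y \<times> Y" "x \<in> Y" "y \<in> Y"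
  shows "(j x, j y) \<in> map_prod j j ` S \<longleftrightarrow> (x, y) \<in> S"
  using inj_on_image_mem_iff [OF map_prod_inj_on [OF assms(1,1)] _ assms(2), of "(x, y)"] assms
  by simp

lemma tournament_image:
  assumes "tournament Y S" "inj_on j Y"
  shows "tournament (j ` Y) (map_prod j j ` S)"
  unfolding tournament_def
proof (intro conjI ballI impI; (elim imageE, hypsubst)?)
  have S: "S \<subseteq> Y \<times> Y" using assms(1) unfolding tournament_def by blast
  then show "map_prod j j ` S \<subseteq> j ` Y \<times> j ` Y" by auto
  note edge = map_prod_image_iff [OF assms(2) S]
  show "(j x, j x) \<notin> map_prod j j ` S" if "x \<in> Y" for x
    using that assms(1) by (simp only: edge) (simp add: tournament_def)
  show "(j x, j y) \<in> map_prod j j ` S \<longleftrightarrow> (j y, j x) \<notin> map_prod j j ` S"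
    if "j x \<noteq> j y" "x \<in> Y" "y \<in> Y" for x y
  proof -
    have "x \<noteq> y" using that(1) by blast
    then show ?thesis
      using that(2,3) assms(1) by (simp only: edge) (unfold tournament_def, blast)
  qed
qed

text \<open>Finite models are built on pairs and then carried over to the natural numbers.\<close>

lemma acts_by_automorphisms_image:
  assumes "tournament Y S" "acts_by_automorphisms G Y S \<beta>" "inj_on j Y"
  shows "acts_by_automorphisms G (j ` Y) (map_prod j j ` S)
    (\<lambda>g. \<lambda>k\<in>j ` Y. j (\<beta> g (inv_into Y j k)))"
  unfolding acts_by_automorphisms_def
proof (intro conjI ballI; (elim imageE, hypsubst)?)
  have S: "S \<subseteq> Y \<times> Y" using assms(1) unfolding tournament_def by blast
  note edge = map_prod_image_iff [OF assms(3) S]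
  interpret group_action G Y \<beta>
    using assms(2) unfolding acts_by_automorphisms_def by blast
  interpret group G
    using group_hom by (rule group_hom.axioms(1))
  have closed: "\<beta> g x \<in> Y" if "g \<in> carrier G" "x \<in> Y" for g x
    using that element_image by blast
  show "group_action G (j ` Y) (\<lambda>g. \<lambda>k\<in>j ` Y. j (\<beta> g (inv_into Y j k)))"
  proof (rule group_action_restrictI [OF is_group]; (elim imageE, hypsubst)?)
    show "j (\<beta> g (inv_into Y j (j x))) \<in> j ` Y" if "g \<in> carrier G" "x \<in> Y" for g x
      using closed that assms(3) by simp
    show "j (\<beta> \<one>\<^bsub>G\<^esub> (inv_into Y j (j x))) = j x" if "x \<in> Y" for x
      using that assms(3) id_eq_one by (metis inv_into_f_f restrict_apply')
    show "j (\<beta> (g \<otimes>\<^bsub>G\<^esub> h) (inv_into Y j (j x)))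
        = j (\<beta> g (inv_into Y j (j (\<beta> h (inv_into Y j (j x))))))"
      if "g \<in> carrier G" "h \<in> carrier G" "x \<in> Y" for g h x
      using that assms(3) closed by (simp add: composition_rule)
  qed
  show "(j x, j y) \<in> map_prod j j ` S \<longleftrightarrow>
      ((\<lambda>k\<in>j ` Y. j (\<beta> g (inv_into Y j k))) (j x), (\<lambda>k\<in>j ` Y. j (\<beta> g (inv_into Y j k))) (j y))
        \<in> map_prod j j ` S"
    if "g \<in> carrier G" "x \<in> Y" "y \<in> Y" for g x y
  proof -
    have "(x, y) \<in> S \<longleftrightarrow> (\<beta> g x, \<beta> g y) \<in> S"
      using assms(2) that unfolding acts_by_automorphisms_def by blast
    then show ?thesis
      using that closed assms(3) by (simp only: edge restrict_apply' imageI inv_into_f_f)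
  qed
qed

section \<open>Symmetric residues\<close>

text \<open>The representative of \<open>c\<close> modulo \<open>L\<close> of least absolute value, for odd positive \<open>L\<close>.\<close>

definition smod :: "int \<Rightarrow> int \<Rightarrow> int" where
  "smod c L = (c + L div 2) mod L - L div 2"

lemma dvd_smod_diff: "L dvd smod c L - c"
proof -
  have "smod c L - c = - ((c + L div 2) div L * L)"
    unfolding smod_def using minus_div_mult_eq_mod [of "c + L div 2" L] by linarith
  then show ?thesis by simp
qed

lemma smod_cong:
  assumes "L dvd c - c'"
  shows "smod c L = smod c' L"
proof -
  have "(c + L div 2) mod L = (c' + L div 2) mod L"
    using assms by (simp add: mod_eq_dvd_iff)
  then show ?thesis by (simp add: smod_def)
qed

lemma smod_small:
  assumes "2 * \<bar>c\<bar> < L"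
  shows "smod c L = c"
  unfolding smod_def using assms by (subst mod_pos_pos_trivial) linarith+

text \<open>For odd \<open>L\<close> the representatives are \<open>-(L-1)/2, \<dots>, (L-1)/2\<close>, a set closed under negation;
  for even \<open>L\<close> the residue \<open>L/2\<close> is its own negative and has no symmetric representative.\<close>

lemma smod_uminus:
  assumes "odd L" "L > 0"
  shows "smod (- c) L = - smod c L"
proof -
  obtain h where h: "L = 2 * h + 1" using assms(1) by (elim oddE)
  have "h \<ge> 0" using h assms(2) by simp
  have range: "- h \<le> smod c L" "smod c L \<le> h"
    using pos_mod_sign [OF assms(2), of "c + L div 2"] pos_mod_bound [OF assms(2), of "c + L div 2"] h
    by (simp_all add: smod_def)
  have "smod (- c) L = smod (- smod c L) L"
    using dvd_smod_diff [of L c] by (intro smod_cong) (simp add: algebra_simps)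
  also have "\<dots> = - smod c L"
    by (rule smod_small) (use range h in linarith)
  finally show ?thesis .
qed

section \<open>Automorphisms of tournaments\<close>

locale tournament_automorphism =
  fixes X :: "'x set" and R :: "('x \<times> 'x) set" and \<alpha> :: "int \<Rightarrow> 'x \<Rightarrow> 'x"
  assumes tournament: "tournament X R"
    and acts: "acts_by_automorphisms integer_group X R \<alpha>"
begin

sublocale group_action "integer_group" X \<alpha>
  using acts unfolding acts_by_automorphisms_def by blast

lemma act_closed [simp]: "x \<in> X \<Longrightarrow> \<alpha> k x \<in> X"
  using element_image [of k x] by simp

lemma act_0 [simp]: "x \<in> X \<Longrightarrow> \<alpha> 0 x = x"
  using id_eq_one by (metis one_integer_group restrict_apply')

lemma act_add: "x \<in> X \<Longrightarrow> \<alpha> (k + l) x = \<alpha> k (\<alpha> l x)"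
  using composition_rule [of x k l] by simp

lemma edge_shift: "x \<in> X \<Longrightarrow> y \<in> X \<Longrightarrow> (\<alpha> k x, \<alpha> k y) \<in> R \<longleftrightarrow> (x, y) \<in> R"
  using acts unfolding acts_by_automorphisms_def by (metis UNIV_I carrier_integer_group)

lemma edge_shift_diff:
  assumes "x \<in> X" "y \<in> X"
  shows "(\<alpha> k x, \<alpha> l y) \<in> R \<longleftrightarrow> (x, \<alpha> (l - k) y) \<in> R"
  using edge_shift [of x "\<alpha> (l - k) y" k] assms by (simp flip: act_add)

lemma no_loop: "(x, x) \<notin> R"
  using tournament unfolding tournament_def by blast

lemma edge_flip: "x \<in> X \<Longrightarrow> y \<in> X \<Longrightarrow> x \<noteq> y \<Longrightarrow> (x, y) \<in> R \<longleftrightarrow> (y, x) \<notin> R"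
  using tournament unfolding tournament_def by blast

text \<open>If \<open>h\<close> and \<open>g h g\<close> fix \<open>x\<close> but \<open>g\<close> does not, then \<open>g h\<close> reverses the arrow between \<open>x\<close> and
  \<open>g x\<close>.\<close>

lemma good_stabilizer:
  assumes x: "x \<in> X"
  shows "good_subgroup integer_group (stabilizer integer_group \<alpha> x)"
  unfolding good_subgroup_def
proof (intro conjI notI; (elim bexE)?)
  show "subgroup (stabilizer integer_group \<alpha> x) integer_group"
    by (rule stabilizer_subgroup [OF x])
next
  fix g h assume "g \<in> carrier integer_group - stabilizer integer_group \<alpha> x"
    and "h \<in> stabilizer integer_group \<alpha> x"
    and "g \<otimes>\<^bsub>integer_group\<^esub> h \<otimes>\<^bsub>integer_group\<^esub> g \<in> stabilizer integer_group \<alpha> x"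
  then have g: "\<alpha> g x \<noteq> x" and h: "\<alpha> h x = x" and ghg: "\<alpha> (g + h + g) x = x"
    by (simp_all add: stabilizer_def)
  have "\<alpha> (g + h) x = \<alpha> g x"
    using x h by (simp add: act_add)
  then have "(\<alpha> g x, x) \<in> R \<longleftrightarrow> (\<alpha> (g + h) x, \<alpha> (g + h + g) x) \<in> R"
    using ghg by simp
  also have "\<dots> \<longleftrightarrow> (x, \<alpha> g x) \<in> R"
    using edge_shift_diff [OF x x, of "g + h" "g + h + g"] by simp
  finally show False
    using edge_flip [of x "\<alpha> g x"] x g by auto
qed

lemma ex_period:
  assumes "x \<in> X"
  shows "\<exists>n. (n = 0 \<or> odd n) \<and> n \<ge> 0 \<and> (\<forall>k. \<alpha> k x = x \<longleftrightarrow> n dvd k)"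
proof -
  obtain n where n: "n = 0 \<or> odd n" "stabilizer integer_group \<alpha> x = multiples n"
    using good_subgroup_integer_groupD [OF good_stabilizer [OF assms]] by blast
  then have "\<alpha> k x = x \<longleftrightarrow> \<bar>n\<bar> dvd k" for k
    by (auto simp: stabilizer_def)
  moreover have "\<bar>n\<bar> = 0 \<or> odd \<bar>n\<bar>" using n(1) by auto
  ultimately show ?thesis by (metis abs_ge_zero)
qed

text \<open>The nonnegative generator of the stabilizer: the length of a finite orbit, and zero for an
  infinite one.\<close>

definition period :: "'x \<Rightarrow> int" where
  "period x = (SOME n. (n = 0 \<or> odd n) \<and> n \<ge> 0 \<and> (\<forall>k. \<alpha> k x = x \<longleftrightarrow> n dvd k))"

lemma period:
  assumes "x \<in> X"
  shows period_odd: "period x = 0 \<or> odd (period x)"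
    and period_nonneg: "period x \<ge> 0"
    and act_fixes_iff: "\<alpha> k x = x \<longleftrightarrow> period x dvd k"
  using someI_ex [OF ex_period [OF assms]] unfolding period_def by blast+

lemma act_eq_iff:
  assumes x: "x \<in> X"
  shows "\<alpha> k x = \<alpha> l x \<longleftrightarrow> period x dvd k - l"
proof -
  have "\<alpha> l (\<alpha> (k - l) x) = \<alpha> k x"
    using x by (simp flip: act_add)
  moreover have "\<alpha> l (\<alpha> (k - l) x) = \<alpha> l x \<longleftrightarrow> \<alpha> (k - l) x = x"
    using inj_prop [of l] x by (simp add: inj_on_eq_iff)
  ultimately show ?thesis
    using act_fixes_iff [OF x] by simp
qed

lemma orbit_eq: "orbit integer_group \<alpha> x = range (\<lambda>k. \<alpha> k x)"
  by (auto simp: orbit_def)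

text \<open>Each orbit is coordinatized: \<open>rep x\<close> is a base point depending only on the orbit of \<open>x\<close>
  (\<open>rep_act\<close>), and \<open>pos x\<close> is a position relative to it, determined only modulo the period.\<close>

definition rep :: "'x \<Rightarrow> 'x" where
  "rep x = (SOME y. y \<in> orbit integer_group \<alpha> x)"

definition pos :: "'x \<Rightarrow> int" where
  "pos x = (SOME k. \<alpha> k (rep x) = x)"

lemma rep_in_orbit: "rep x \<in> orbit integer_group \<alpha> x"
  unfolding rep_def by (rule someI_ex) (auto simp: orbit_eq)

lemma rep_closed [simp]: "x \<in> X \<Longrightarrow> rep x \<in> X"
  using rep_in_orbit [of x] by (auto simp: orbit_eq)

lemma act_pos_rep [simp]:
  assumes x: "x \<in> X"
  shows "\<alpha> (pos x) (rep x) = x"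
proof -
  obtain k where "rep x = \<alpha> k x"
    using rep_in_orbit [of x] by (auto simp: orbit_eq)
  then have "\<alpha> (- k) (rep x) = x"
    using x by (simp flip: act_add)
  then show ?thesis unfolding pos_def by (rule someI)
qed

lemma rep_act [simp]:
  assumes x: "x \<in> X"
  shows "rep (\<alpha> k x) = rep x"
proof -
  have "\<exists>m. \<alpha> l x = \<alpha> m (\<alpha> k x)" "\<exists>m. \<alpha> l (\<alpha> k x) = \<alpha> m x" for l
    using x by (intro exI [of _ "l - k"], simp flip: act_add) (metis act_add x)
  then have "orbit integer_group \<alpha> (\<alpha> k x) = orbit integer_group \<alpha> x"
    unfolding orbit_eq by (auto simp: image_iff)
  then show ?thesis by (simp add: rep_def)
qed

lemma rep_rep [simp]: "x \<in> X \<Longrightarrow> rep (rep x) = rep x"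
  using rep_act [of "rep x" "pos x"] by simp

end

section \<open>The cyclic model of finitely many orbits\<close>

text \<open>\<open>D\<close> is the set of points to be embedded. The bound on \<open>L\<close> ensures that the difference of two
  positions of such points is its own symmetric residue.\<close>

locale cyclic_model = tournament_automorphism X R \<alpha>
  for X :: "'x set" and R \<alpha> +
  fixes D :: "'x set" and L :: int
  assumes finite_D: "finite D" and D_sub: "D \<subseteq> X"
    and L_odd: "odd L" and L_pos: "L > 0"
    and period_dvd: "\<And>u. u \<in> D \<Longrightarrow> period (rep u) \<noteq> 0 \<Longrightarrow> period (rep u) dvd L"
    and L_large: "\<And>u v. u \<in> D \<Longrightarrow> v \<in> D \<Longrightarrow> 2 * \<bar>pos u - pos v\<bar> < L"
begin

definition len :: "'x \<Rightarrow> int" where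
  "len x = (if period x = 0 then L else period x)"

definition vertices :: "('x \<times> int) set" where
  "vertices = (SIGMA x : rep ` D. {0..<len x})"

text \<open>The arrow from position \<open>a\<close> of the cycle of \<open>x\<close> to position \<open>a + c\<close> of the cycle of \<open>y\<close>.\<close>

definition model_edge :: "'x \<Rightarrow> int \<Rightarrow> 'x \<Rightarrow> bool" where
  "model_edge x c y \<longleftrightarrow> (x, \<alpha> (smod c L) y) \<in> R"

definition edges :: "(('x \<times> int) \<times> ('x \<times> int)) set" where
  "edges = {((x, a), (y, b)) | x a y b.
     (x, a) \<in> vertices \<and> (y, b) \<in> vertices \<and> model_edge x (b - a) y}"

definition rotation :: "int \<Rightarrow> 'x \<times> int \<Rightarrow> 'x \<times> int" where
  "rotation g = restrict (\<lambda>(x, a). (x, (a + g) mod len x)) vertices"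

definition emb :: "'x \<Rightarrow> 'x \<times> int" where
  "emb u = (rep u, pos u mod len (rep u))"

lemma rep_D: "x \<in> rep ` D \<Longrightarrow> x \<in> X"
  using D_sub by auto

lemma rep_fixes: "x \<in> rep ` D \<Longrightarrow> rep x = x"
  using D_sub by auto

lemma len_pos: "x \<in> rep ` D \<Longrightarrow> len x > 0"
  using period_nonneg [OF rep_D, of x] L_pos by (auto simp: len_def)

lemma period_dvd_L: "x \<in> rep ` D \<Longrightarrow> period x \<noteq> 0 \<Longrightarrow> period x dvd L"
  using period_dvd by auto

lemma len_dvd_L: "x \<in> rep ` D \<Longrightarrow> len x dvd L"
  using period_dvd_L [of x] by (simp add: len_def)

lemma len_dvd_period: "len x dvd period x"
  by (simp add: len_def)

lemma finite_vertices: "finite vertices"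
  unfolding vertices_def using finite_D by simp

text \<open>Changing \<open>c\<close> by a multiple of the cycle length of \<open>x\<close> does not change \<open>\<alpha> (smod c L) x\<close>: on a
  wrapped infinite orbit the length is \<open>L\<close> and the residue itself stays the same, whereas on a finite
  orbit \<open>smod\<close> moves by multiples of \<open>L\<close>, hence of the period.\<close>

lemma smod_len_cong:
  assumes x: "x \<in> rep ` D" and dvd: "len x dvd c - c'"
  shows "period x dvd smod c L - smod c' L"
proof (cases "period x = 0")
  case True
  then show ?thesis
    using dvd smod_cong [of L c c'] by (simp add: len_def)
next
  case False
  then have "period x dvd smod c L - c" "period x dvd smod c' L - c'"
    using dvd_trans [OF period_dvd_L [OF x False] dvd_smod_diff] by blast+
  moreover have "period x dvd c - c'"
    using False dvd by (simp add: len_def)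
  ultimately have "period x dvd (smod c L - c) - (smod c' L - c') + (c - c')"
    by (simp only: dvd_add dvd_diff)
  then show ?thesis by (simp add: algebra_simps)
qed

lemma model_edge_cong_right:
  assumes "y \<in> rep ` D" "len y dvd c - c'"
  shows "model_edge x c y \<longleftrightarrow> model_edge x c' y"
  using smod_len_cong [OF assms] act_eq_iff [OF rep_D [OF assms(1)]]
  unfolding model_edge_def by metis

text \<open>Shifting by \<open>- smod c L\<close> turns the arrow between \<open>x\<close> and \<open>\<alpha> (smod c L) y\<close> into the one between
  \<open>\<alpha> (- smod c L) x\<close> and \<open>y\<close>, and for odd \<open>L\<close> this is the one that decides the opposite direction.
  The side condition excludes a loop.\<close>

lemma model_edge_flip:
  assumes "x \<in> rep ` D" "y \<in> rep ` D" and ne: "x \<noteq> y \<or> \<not> len x dvd c"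
  shows "model_edge x c y \<longleftrightarrow> \<not> model_edge y (- c) x"
proof -
  have X: "x \<in> X" "y \<in> X" using assms(1,2) by (simp_all only: rep_D)
  have "x \<noteq> \<alpha> (smod c L) y"
  proof
    assume eq: "x = \<alpha> (smod c L) y"
    then have "rep x = rep y" using X by simp
    then have "x = y" using assms(1,2) rep_fixes by metis
    then have "period x dvd smod c L"
      using act_fixes_iff [OF X(1)] eq by metis
    then have "len x dvd smod c L"
      using len_dvd_period dvd_trans by blast
    moreover have "len x dvd smod c L - c"
      using len_dvd_L [OF assms(1)] dvd_smod_diff dvd_trans by blast
    ultimately have "len x dvd smod c L - (smod c L - c)"
      by (rule dvd_diff)
    then have "len x dvd c" by simp
    then show False using ne \<open>x = y\<close> by blast
  qed
  then have "(x, \<alpha> (smod c L) y) \<in> R \<longleftrightarrow> (\<alpha> (smod c L) y, x) \<notin> R"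
    by (rule edge_flip [OF X(1) act_closed [OF X(2)]])
  also have "(\<alpha> (smod c L) y, x) \<in> R \<longleftrightarrow> (y, \<alpha> (- smod c L) x) \<in> R"
    using edge_shift_diff [of y x "smod c L" 0] X by simp
  finally show ?thesis
    by (simp add: model_edge_def smod_uminus [OF L_odd L_pos])
qed

lemma model_edge_cong_left:
  assumes x: "x \<in> rep ` D" and y: "y \<in> rep ` D" and dvd: "len x dvd c - c'"
  shows "model_edge x c y \<longleftrightarrow> model_edge x c' y"
proof -
  have X: "x \<in> X" "y \<in> X" using x y by (simp_all only: rep_D)
  have "\<alpha> (- smod c L) x = \<alpha> (- smod c' L) x"
    using smod_len_cong [OF x dvd] by (simp add: act_eq_iff [OF X(1)] dvd_diff_commute)
  moreover have "model_edge x c y \<longleftrightarrow> (\<alpha> (- smod c L) x, y) \<in> R" for c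
    using edge_shift_diff [of x y "- smod c L" 0] X by (simp add: model_edge_def)
  ultimately show ?thesis by metis
qed

text \<open>The two congruences applied in turn: arrows may be computed from unreduced positions, and hence
  are invariant under rotation.\<close>

lemma model_edge_mod:
  assumes x: "x \<in> rep ` D" and y: "y \<in> rep ` D"
  shows "model_edge x (b mod len y - a mod len x) y \<longleftrightarrow> model_edge x (b - a) y"
proof -
  have "b mod len y - b = - (b div len y) * len y" "a - a mod len x = a div len x * len x"
    using minus_div_mult_eq_mod [of b "len y"] minus_div_mult_eq_mod [of a "len x"] by linarith+
  then have "len y dvd (b mod len y - a mod len x) - (b - a mod len x)"
    "len x dvd (b - a mod len x) - (b - a)"
    by simp_all
  then show ?thesis
    using model_edge_cong_right [OF y] model_edge_cong_left [OF x y] by blast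
qed

lemma edges_subset: "edges \<subseteq> vertices \<times> vertices"
  by (auto simp: edges_def)

lemma edges_iff:
  assumes "(x, a) \<in> vertices" "(y, b) \<in> vertices"
  shows "((x, a), (y, b)) \<in> edges \<longleftrightarrow> model_edge x (b - a) y"
  using assms by (simp add: edges_def)

lemma mod_len_in_vertices: "x \<in> rep ` D \<Longrightarrow> (x, a mod len x) \<in> vertices"
  using len_pos [of x] by (simp add: vertices_def)

lemma tournament_edges: "tournament vertices edges"
  unfolding tournament_def
proof (intro conjI ballI impI)
  show "edges \<subseteq> vertices \<times> vertices" by (rule edges_subset)
next
  fix p assume "p \<in> vertices"
  moreover obtain x a where "p = (x, a)" by fastforce
  moreover have "smod 0 L = 0" using L_pos by (simp add: smod_small)
  ultimately show "(p, p) \<notin> edges"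
    using no_loop rep_D [of x] by (auto simp: edges_def model_edge_def vertices_def)
next
  fix p q assume pq: "p \<in> vertices" "q \<in> vertices" "p \<noteq> q"
  obtain x a y b where eq: "p = (x, a)" "q = (y, b)" by fastforce
  have mem: "x \<in> rep ` D" "y \<in> rep ` D" "0 \<le> a" "a < len x" "0 \<le> b" "b < len y"
    using pq eq by (auto simp: vertices_def)
  have "x \<noteq> y \<or> \<not> len x dvd b - a"
  proof (cases "x = y")
    case True
    have "b mod len x \<noteq> a mod len x"
      using True mem eq pq(3) by simp
    then show ?thesis by (simp add: mod_eq_dvd_iff)
  qed simp
  from model_edge_flip [OF mem(1,2) this]
  show "(p, q) \<in> edges \<longleftrightarrow> (q, p) \<notin> edges"
    using pq eq by (simp add: edges_iff)
qed

lemma rotation_acts: "acts_by_automorphisms integer_group vertices edges rotation"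
  unfolding acts_by_automorphisms_def
proof (intro conjI ballI)
  show "group_action integer_group vertices rotation"
    unfolding rotation_def [abs_def]
  proof (rule group_action_restrictI [OF group_integer_group])
    fix g h :: int and p assume "p \<in> vertices"
    then obtain x a where p: "p = (x, a)" "x \<in> rep ` D" "0 \<le> a" "a < len x"
      by (auto simp: vertices_def)
    show "(case p of (x, a) \<Rightarrow> (x, (a + g) mod len x)) \<in> vertices"
      using p mod_len_in_vertices by simp
    show "(case p of (x, a) \<Rightarrow> (x, (a + \<one>\<^bsub>integer_group\<^esub>) mod len x)) = p"
      using p by simp
    show "(case p of (x, a) \<Rightarrow> (x, (a + (g \<otimes>\<^bsub>integer_group\<^esub> h)) mod len x)) =
        (case case p of (x, a) \<Rightarrow> (x, (a + h) mod len x) of (x, a) \<Rightarrow> (x, (a + g) mod len x))"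
      using p by (simp add: mod_simps algebra_simps)
  qed
next
  fix g :: int and p q assume pq: "p \<in> vertices" "q \<in> vertices"
  then obtain x a y b where p: "p = (x, a)" "x \<in> rep ` D" and q: "q = (y, b)" "y \<in> rep ` D"
    by (auto simp: vertices_def)
  then have "rotation g p = (x, (a + g) mod len x)" "rotation g q = (y, (b + g) mod len y)"
    using pq by (simp_all add: rotation_def)
  then show "(p, q) \<in> edges \<longleftrightarrow> (rotation g p, rotation g q) \<in> edges"
    using pq p q mod_len_in_vertices model_edge_mod [OF p(2) q(2), of "b + g" "a + g"]
    by (simp add: edges_iff)
qed

lemma emb_in_vertices: "u \<in> D \<Longrightarrow> emb u \<in> vertices"
  by (simp add: emb_def mod_len_in_vertices)

text \<open>Two points of \<open>D\<close> on the same wrapped orbit are kept apart by the size of \<open>L\<close>: their positions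
  differ by less than \<open>L / 2\<close>. On a finite orbit equal positions modulo the length mean equal points.
  Both cases are instances of \<open>smod_len_cong\<close> with \<open>c' = 0\<close>.\<close>

lemma inj_on_emb: "inj_on emb D"
proof (rule inj_onI)
  fix u v assume uv: "u \<in> D" "v \<in> D" "emb u = emb v"
  then have rep: "rep u = rep v" and dvd: "len (rep v) dvd pos u - pos v"
    by (auto simp: emb_def mod_eq_dvd_iff)
  have X: "u \<in> X" "v \<in> X" using uv D_sub by auto
  have "period (rep v) dvd smod (pos u - pos v) L - smod 0 L"
    using smod_len_cong [of "rep v"] uv(2) dvd by simp
  then have "period (rep v) dvd pos u - pos v"
    using L_large [OF uv(1,2)] L_pos by (simp add: smod_small)
  then have "\<alpha> (pos u) (rep v) = \<alpha> (pos v) (rep v)"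
    using act_eq_iff [OF rep_closed [OF X(2)]] by blast
  then show "u = v"
    using rep X act_pos_rep by metis
qed

lemma emb_edge:
  assumes "u \<in> D" "v \<in> D"
  shows "(u, v) \<in> R \<longleftrightarrow> (emb u, emb v) \<in> edges"
proof -
  have X: "u \<in> X" "v \<in> X" using assms D_sub by auto
  have "(u, v) \<in> R \<longleftrightarrow> (\<alpha> (pos u) (rep u), \<alpha> (pos v) (rep v)) \<in> R"
    using X by simp
  also have "\<dots> \<longleftrightarrow> (rep u, \<alpha> (pos v - pos u) (rep v)) \<in> R"
    using X by (intro edge_shift_diff rep_closed)
  also have "\<dots> \<longleftrightarrow> model_edge (rep u) (pos v - pos u) (rep v)"
    using L_large [OF assms(2,1)] by (simp add: model_edge_def smod_small)
  also have "\<dots> \<longleftrightarrow> (emb u, emb v) \<in> edges"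
    using assms by (simp add: emb_def edges_iff mod_len_in_vertices model_edge_mod)
  finally show ?thesis .
qed

text \<open>The position of \<open>\<alpha> g u\<close> was chosen independently of that of \<open>u\<close>, so it agrees with
  \<open>pos u + g\<close> only up to the period; reduction modulo the cycle length removes the discrepancy.\<close>

lemma emb_equivariant:
  assumes "u \<in> D" "\<alpha> g u \<in> D"
  shows "rotation g (emb u) = emb (\<alpha> g u)"
proof -
  have X: "u \<in> X" using assms D_sub by auto
  have "\<alpha> (pos (\<alpha> g u)) (rep u) = \<alpha> g u"
    using act_pos_rep [of "\<alpha> g u"] X by simp
  also have "\<dots> = \<alpha> (pos u + g) (rep u)"
    using X act_add [of "rep u" g "pos u"] by (simp add: add.commute)
  finally have "period (rep u) dvd pos (\<alpha> g u) - (pos u + g)"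
    using X by (simp add: act_eq_iff)
  then have "len (rep u) dvd pos (\<alpha> g u) - (pos u + g)"
    using len_dvd_period dvd_trans by blast
  then have "(pos u + g) mod len (rep u) = pos (\<alpha> g u) mod len (rep u)"
    by (simp add: mod_eq_dvd_iff dvd_diff_commute)
  then show ?thesis
    using emb_in_vertices [OF assms(1)] X by (simp add: rotation_def emb_def mod_simps)
qed

end

lemma (in tournament_automorphism) finitely_approximable:
  "finitely_approximable integer_group X R \<alpha>"
  unfolding finitely_approximable_def
proof (intro allI impI, elim conjE)
  fix F :: "int set" and X0
  assume F: "finite F" "\<one>\<^bsub>integer_group\<^esub> \<in> F" and X0: "finite X0" "X0 \<subseteq> X"
  define D where "D = {\<alpha> f x | f x. f \<in> F \<and> x \<in> X0}"
  have D_eq: "D = (\<lambda>(f, x). \<alpha> f x) ` (F \<times> X0)"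
    unfolding D_def by auto
  have "finite D" unfolding D_eq using F X0 by simp
  have "D \<subseteq> X" unfolding D_eq using X0 by auto
  have "n = 0 \<or> odd n" if "n \<in> (\<lambda>u. period (rep u)) ` D" for n
    using that \<open>D \<subseteq> X\<close> period_odd rep_closed by blast
  moreover define B where "B = (\<Sum>u\<in>D. \<bar>pos u\<bar>)"
  ultimately obtain L where L: "odd L" "L > 4 * B" "L > 0"
    "\<And>u. u \<in> D \<Longrightarrow> period (rep u) \<noteq> 0 \<Longrightarrow> period (rep u) dvd L"
    using ex_large_odd_common_multiple [of "(\<lambda>u. period (rep u)) ` D" "4 * B"] \<open>finite D\<close>
    by (metis (no_types, lifting) finite_imageI imageI)
  have pos: "\<bar>pos u\<bar> \<le> B" if "u \<in> D" for u
    unfolding B_def using that \<open>finite D\<close> by (intro member_le_sum) auto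
  interpret cyclic_model X R \<alpha> D L
  proof unfold_locales
    show "2 * \<bar>pos u - pos v\<bar> < L" if "u \<in> D" "v \<in> D" for u v
      using pos [OF that(1)] pos [OF that(2)] L(2) by arith
  qed (use \<open>finite D\<close> \<open>D \<subseteq> X\<close> L in auto)
  obtain j :: "'x \<times> int \<Rightarrow> nat" where j: "inj_on j vertices"
    using finite_imp_inj_to_nat_seg [OF finite_vertices] by blast
  let ?\<beta> = "\<lambda>g. \<lambda>k\<in>j ` vertices. j (rotation g (inv_into vertices j k))"
  have edge: "(u, v) \<in> R \<longleftrightarrow> ((j \<circ> emb) u, (j \<circ> emb) v) \<in> map_prod j j ` edges"
    if "u \<in> D" "v \<in> D" for u v
    using emb_edge [OF that] map_prod_image_iff [OF j edges_subset, of "emb u" "emb v"] that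
      emb_in_vertices by simp
  have equivariant: "?\<beta> f ((j \<circ> emb) x) = (j \<circ> emb) (\<alpha> f x)" if "f \<in> F" "x \<in> X0" for f x
  proof -
    have "\<alpha> f x \<in> D" using that D_def by blast
    \<comment> \<open>Since \<open>F\<close> contains the identity, \<open>X0\<close> itself lies in \<open>D\<close>.\<close>
    moreover have "\<alpha> 0 x \<in> D" using that F(2) unfolding D_def by auto
    then have "x \<in> D" using that X0 by auto
    ultimately show ?thesis
      using emb_in_vertices emb_equivariant j by simp
  qed
  have range: "(j \<circ> emb) ` D \<subseteq> j ` vertices"
    using emb_in_vertices by auto
  have inj: "inj_on (j \<circ> emb) D"
    using inj_on_emb j emb_in_vertices
    by (intro comp_inj_on inj_on_subset [OF j]) auto
  show "let D = {\<alpha> f x | f x. f \<in> F \<and> x \<in> X0} in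
      \<exists>(Y :: nat set) S \<beta> e.
        finite Y \<and> tournament Y S \<and> acts_by_automorphisms integer_group Y S \<beta> \<and>
        e ` D \<subseteq> Y \<and> inj_on e D \<and>
        (\<forall>u\<in>D. \<forall>v\<in>D. (u, v) \<in> R \<longleftrightarrow> (e u, e v) \<in> S) \<and>
        (\<forall>f\<in>F. \<forall>x\<in>X0. \<beta> f (e x) = e (\<alpha> f x))"
    unfolding D_def [symmetric] Let_def
    by (rule exI [of _ "j ` vertices"], rule exI [of _ "map_prod j j ` edges"],
        rule exI [of _ ?\<beta>], rule exI [of _ "j \<circ> emb"],
        intro conjI ballI range inj edge equivariant finite_imageI finite_vertices
          tournament_image [OF tournament_edges j]
          acts_by_automorphisms_image [OF tournament_edges rotation_acts j])
qed

theorem proposition1p9: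
  shows "tournament_2RZ integer_group \<and>
    (\<forall>(X :: 'x set) R \<alpha>. tournament X R \<and> acts_by_automorphisms integer_group X R \<alpha> \<longrightarrow>
       finitely_approximable integer_group X R \<alpha>)"
  using tournament_2RZ_integer_group tournament_automorphism.finitely_approximable
    tournament_automorphism.intro by blast

end
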